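(* Let $F$ be the feasible region of the attack problem and let $F_r$ be its relaxation obtained by dropping the integrality restrictions on $\alpha^A$ and on $\mathbf{b}^A$ (all defined in the context). Then the problems $$P^A(F):\ \max_{\mathbb{E}^A}\{f^A(\mathbb{E}^A):\mathbb{E}^A\in F\}\qquad\text{and}\qquad P^A(F_r):\ \max_{\mathbb{E}^A}\{f^A(\mathbb{E}^A):\mathbb{E}^A\in F_r\}$$ are equivalent, i.e. they have the same optimal value and the same optimal solutions.
   Context: Data: $\mathcal{N}=\{1,\dots,n\}$ is the set of vertices of an undirected network with adjacency matrix $\mathbf{A}=(A_{ij})$ (symmetric, $A_{ij}=1$ if $i$ and $j$ are joined by an edge and $A_{ij}=0$ otherwise); $\mathcal{C}=\{1,\dots,n\}$ is the set of component indices; $a_i$ is the cost of disabling vertex $i$; $B^A$ is the attack budget. Variables: $\mathbb{E}^A=\{\mathbf{v}^A,\mathbf{b}^A,\mathbf{y}^A,\alpha^A\}$, with $\mathbf{v}^A=(v^A_{ic})_{i\in\mathcal{N},c\in\mathcal{C}}$ (vertex $i$ belongs to component $c$), $\mathbf{b}^A=(b^A_c)_{c\in\mathcal{C}}$ (component $c$ is non-empty), $\mathbf{y}^A=(y^A_{ij})_{i,j\in\mathcal{N}}$ (vertices $i,j$ are connected), and $\alpha^A$ (length of the largest component). Objective function: $$f^A(\mathbb{E}^A)=-\Big(|\mathcal{N}|-\sum_{i\in\mathcal{N}}\sum_{c\in\mathcal{C}}v^A_{ic}\Big)-\alpha^A+\sum_{c\in\mathcal{C}}b^A_c.$$ Constraints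 (the "attack constraints"): - $\sum_{c\in\mathcal{C}}v^A_{ic}\le 1$ for all $i\in\mathcal{N}$; - $\sum_{i\in\mathcal{N}}v^A_{ic}\le\alpha^A$ for all $c\in\mathcal{C}$; - $b^A_c\le\sum_{i\in\mathcal{N}}v^A_{ic}$ for all $c\in\mathcal{C}$; - $\sum_{j\in\mathcal{N},\,j\neq i}y^A_{ij}\le(|\mathcal{N}|-1)\sum_{c\in\mathcal{C}}v^A_{ic}$ for all $i\in\mathcal{N}$; - $\sum_{i\in\mathcal{N}}a_i\big(1-\sum_{c\in\mathcal{C}}v^A_{ic}\big)\le B^A$; - $y^A_{ij}=y^A_{ji}$ for all $i,j\in\mathcal{N}$; - $A_{ij}\big(\sum_{c\in\mathcal{C}}v^A_{ic}+\sum_{c\in\mathcal{C}}v^A_{jc}-1\big)\le y^A_{ij}$ for all $i,j\in\mathcal{N}$ with $i>j$; - $y^A_{ij}\le A_{ij}(1-v^A_{ic}+v^A_{jc})$ for all $i,j\in\mathcal{N}$ with $i>j$ and all $c\in\mathcal{C}$; - $y^A_{ij}\le A_{ij}(1+v^A_{ic}-v^A_{jc})$ for all $i,j\in\mathcal{N}$ with $i>j$ and all $c\in\mathcal{C}$. Feasible regions ($\mathrm{conv}$ denotes convex hull): $$F=\mathrm{conv}\big\{(\mathbf{v}^A,\mathbf{y}^A,\mathbf{b}^A,\alpha^A):\ \mathbf{v}^A\in\{0,1\}^{|\mathcal{N}||\mathcal{C}|},\ \mathbf{y}^A\in\{0,1\}^{|\mathcal{N}|^2},\ \mathbf{b}^A\in\{0,1\}^{|\mathcal{C}|},\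 \alpha^A\in\mathbb{Z}_+,\ \text{attack constraints}\big\},$$ $$F_r=\mathrm{conv}\big\{(\mathbf{v}^A,\mathbf{y}^A,\mathbf{b}^A,\alpha^A):\ \mathbf{v}^A\in\{0,1\}^{|\mathcal{N}||\mathcal{C}|},\ \mathbf{y}^A\in\{0,1\}^{|\mathcal{N}|^2},\ 0\le b^A_c\le1\ \forall c\in\mathcal{C},\ \alpha^A\in\mathbb{R}_+,\ \text{attack constraints}\big\},$$ where $\mathbb{Z}_+$ and $\mathbb{R}_+$ denote the nonnegative integers and nonnegative reals. *)

theory Defs
  imports "HOL-Analysis.Analysis"
begin

text \<open>
  Vertices and component indices both range over a finite linearly ordered type
  \<open>'n\<close>; up to order isomorphism this is \<open>{1, \<dots>, n}\<close> with \<open>n = CARD('n) \<ge> 1\<close>.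
  The index \<open>i\<close> of \<open>v $ i $ c\<close> is the vertex, \<open>c\<close> the component.
\<close>

definition adjacency_matrix :: "real ^ 'n ^ 'n \<Rightarrow> bool" where
  "adjacency_matrix A \<longleftrightarrow>
     (\<forall>i j. A $ i $ j = A $ j $ i) \<and> (\<forall>i j. A $ i $ j \<in> {0, 1})"

text \<open>The tuple \<open>(v, y, b, \<alpha>)\<close>.\<close>

type_synonym 'n attack_vars = "(real ^ 'n ^ 'n) \<times> (real ^ 'n ^ 'n) \<times> (real ^ 'n) \<times> real"

definition attack_objective :: "('n::finite) attack_vars \<Rightarrow> real" where
  "attack_objective = (\<lambda>(v, y, b, \<alpha>).
     - (real CARD('n) - (\<Sum>i\<in>UNIV. \<Sum>c\<in>UNIV. v $ i $ c)) - \<alpha> + (\<Sum>c\<in>UNIV. b $ c))"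

definition attack_constraints ::
    "((real, 'n::{finite, linorder}) vec, 'n) vec \<Rightarrow> (real, 'n) vec \<Rightarrow> real \<Rightarrow> 'n attack_vars \<Rightarrow> bool" where
  "attack_constraints A a B = (\<lambda>(v, y, b, \<alpha>).
     (\<forall>i. (\<Sum>c\<in>UNIV. v $ i $ c) \<le> 1) \<and>
     (\<forall>c. (\<Sum>i\<in>UNIV. v $ i $ c) \<le> \<alpha>) \<and>
     (\<forall>c. b $ c \<le> (\<Sum>i\<in>UNIV. v $ i $ c)) \<and>
     (\<forall>i. (\<Sum>j\<in>UNIV - {i}. y $ i $ j) \<le> (real CARD('n) - 1) * (\<Sum>c\<in>UNIV. v $ i $ c)) \<and>
     (\<Sum>i\<in>UNIV. a $ i * (1 - (\<Sum>c\<in>UNIV. v $ i $ c))) \<le> B \<and>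
     (\<forall>i j. y $ i $ j = y $ j $ i) \<and>
     (\<forall>i j. i > j \<longrightarrow>
        A $ i $ j * ((\<Sum>c\<in>UNIV. v $ i $ c) + (\<Sum>c\<in>UNIV. v $ j $ c) - 1) \<le> y $ i $ j) \<and>
     (\<forall>i j c. i > j \<longrightarrow> y $ i $ j \<le> A $ i $ j * (1 - v $ i $ c + v $ j $ c)) \<and>
     (\<forall>i j c. i > j \<longrightarrow> y $ i $ j \<le> A $ i $ j * (1 + v $ i $ c - v $ j $ c)))"

definition attack_region ::
    "((real, 'n::{finite, linorder}) vec, 'n) vec \<Rightarrow> (real, 'n) vec \<Rightarrow> real \<Rightarrow> 'n attack_vars set" where
  "attack_region A a B = convex hull {(v, y, b, \<alpha>).
     (\<forall>i c. v $ i $ c \<in> {0, 1}) \<and> (\<forall>i j. y $ i $ j \<in> {0, 1}) \<and>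
     (\<forall>c. b $ c \<in> {0, 1}) \<and> \<alpha> \<in> \<nat> \<and>
     attack_constraints A a B (v, y, b, \<alpha>)}"

definition relaxed_attack_region ::
    "((real, 'n::{finite, linorder}) vec, 'n) vec \<Rightarrow> (real, 'n) vec \<Rightarrow> real \<Rightarrow> 'n attack_vars set" where
  "relaxed_attack_region A a B = convex hull {(v, y, b, \<alpha>).
     (\<forall>i c. v $ i $ c \<in> {0, 1}) \<and> (\<forall>i j. y $ i $ j \<in> {0, 1}) \<and>
     (\<forall>c. 0 \<le> b $ c \<and> b $ c \<le> 1) \<and> 0 \<le> \<alpha> \<and>
     attack_constraints A a B (v, y, b, \<alpha>)}"

text \<open>
  The value of a maximisation problem is taken in the extended reals, with the usual
  convention that an infeasible problem has value \<open>-\<infinity>\<close>.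
\<close>

definition optimal_value :: "('a \<Rightarrow> real) \<Rightarrow> 'a set \<Rightarrow> ereal" where
  "optimal_value f S = (SUP x\<in>S. ereal (f x))"

definition optimal_solutions :: "('a \<Rightarrow> real) \<Rightarrow> 'a set \<Rightarrow> 'a set" where
  "optimal_solutions f S = {x \<in> S. \<forall>y\<in>S. f y \<le> f x}"

end

theory Submission
  imports Defs
begin

text \<open>
  Fix a generator of the relaxed region, that is, a feasible point \<open>(v, y, b, \<alpha>)\<close> with binary
  \<open>v\<close> and \<open>y\<close>. The variables \<open>\<alpha>\<close> and \<open>b\<close> occur in two constraints only: \<open>\<alpha>\<close> is bounded below
  by every column sum of \<open>v\<close>, and \<open>b\<^sub>c\<close> is bounded above by the \<open>c\<close>-th column sum and by 1. These
  bounds are integers because \<open>v\<close> is binary, and the objective strictly decreases in \<open>\<alpha>\<close> and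
  strictly increases in each \<open>b\<^sub>c\<close>. Moving \<open>\<alpha>\<close> and \<open>b\<close> to their bounds therefore gives an
  integral feasible point of at least the same value, and of strictly larger value unless the
  point was at its bounds already (\<open>round_attack_vars_integral\<close>, \<open>round_attack_vars_improves\<close>). So every generator of the relaxed
  region that is not a generator of the original one is strictly beaten by one that is.

  It remains to carry this from generators to convex hulls. This is a general fact on maximising
  a convex function (here an affine one): enlarging the generating set by points that are
  strictly beaten by old ones alters neither the supremum (\<open>optimal_value_convex_hull_eq\<close>) nor the
  set of maximisers (\<open>optimal_solutions_convex_hull_eq\<close>), because a maximiser has no strictly
  suboptimal point among those of which it is a proper convex combination.
\<close>

section \<open>Maximising a convex function over a convex hull\<close>

text \<open>
  If \<open>f\<close> were below \<open>f x\<close> on all of \<open>S\<close>, hence on \<open>T\<close>, the convex set \<open>{z. f z < f x}\<close> would contain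
  the hull of \<open>T\<close> and so \<open>x\<close> itself. Arguing from \<open>x\<close> instead of from a maximiser covers suprema
  that are infinite or not attained.
\<close>

lemma convex_hull_dominated:
  fixes f :: "'a::real_vector \<Rightarrow> real"
  assumes f: "convex_on UNIV f"
    and dom: "\<And>t. t \<in> T \<Longrightarrow> \<exists>s\<in>S. f t \<le> f s"
    and x: "x \<in> convex hull T"
  shows "\<exists>s\<in>S. f x \<le> f s"
proof (rule ccontr)
  assume "\<not> ?thesis"
  then have "T \<subseteq> {z. f z < f x}"
    using dom by fastforce
  moreover have "convex {z. f z < f x}"
  proof (rule convexI)
    fix p q and u v :: real
    assume *: "p \<in> {z. f z < f x}" "q \<in> {z. f z < f x}" "0 \<le> u" "0 \<le> v" "u + v = 1"
    have "f (u *\<^sub>R p + v *\<^sub>R q) \<le> u * f p + v * f q"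
      using f * by (auto simp: convex_on_def)
    also have "\<dots> < f x"
      using * by (intro convex_bound_lt) auto
    finally show "u *\<^sub>R p + v *\<^sub>R q \<in> {z. f z < f x}" by simp
  qed
  ultimately have "convex hull T \<subseteq> {z. f z < f x}"
    by (rule hull_minimal)
  with x show False by auto
qed

lemma optimal_value_convex_hull_eq:
  fixes f :: "'a::real_vector \<Rightarrow> real"
  assumes f: "convex_on UNIV f" and "S \<subseteq> T"
    and dom: "\<And>t. t \<in> T \<Longrightarrow> \<exists>s\<in>S. f t \<le> f s"
  shows "optimal_value f (convex hull S) = optimal_value f (convex hull T)"
  unfolding optimal_value_def
proof (rule antisym)
  show "(SUP x\<in>convex hull S. ereal (f x)) \<le> (SUP x\<in>convex hull T. ereal (f x))"
    using hull_mono[OF \<open>S \<subseteq> T\<close>] by (intro SUP_subset_mono) auto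
  show "(SUP x\<in>convex hull T. ereal (f x)) \<le> (SUP x\<in>convex hull S. ereal (f x))"
    using convex_hull_dominated[OF f dom]
    by (intro SUP_mono) (metis ereal_less_eq(3) hull_inc)
qed

text \<open>
  Let \<open>M\<close> be the maximum over the hull of \<open>T\<close>. The points of that hull with value below \<open>M\<close>,
  together with the hull of \<open>S\<close>, form a convex set: a proper convex combination involving a
  point of value below \<open>M\<close> again has value below \<open>M\<close>. This set contains \<open>T\<close>, hence the hull of
  \<open>T\<close>, so points of value \<open>M\<close> lie in the hull of \<open>S\<close>.
\<close>

lemma maximiser_in_convex_hull_subset:
  fixes f :: "'a::real_vector \<Rightarrow> real"
  assumes f: "convex_on UNIV f" and "S \<subseteq> T"
    and dom: "\<And>t. t \<in> T - S \<Longrightarrow> \<exists>s\<in>S. f t < f s"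
    and x: "x \<in> optimal_solutions f (convex hull T)"
  shows "x \<in> convex hull S"
proof -
  have x_hull: "x \<in> convex hull T" and x_max: "\<And>z. z \<in> convex hull T \<Longrightarrow> f z \<le> f x"
    using x by (auto simp: optimal_solutions_def)
  define K where "K = {z \<in> convex hull T. f z < f x} \<union> convex hull S"
  have K_sub: "K \<subseteq> convex hull T"
    using hull_mono[OF \<open>S \<subseteq> T\<close>] by (auto simp: K_def)
  have T_sub: "T \<subseteq> K"
  proof
    fix t assume "t \<in> T"
    show "t \<in> K"
    proof (cases "t \<in> S")
      case True
      then show ?thesis by (simp add: K_def hull_inc)
    next
      case False
      with dom \<open>t \<in> T\<close> obtain s where "s \<in> S" "f t < f s" by blast
      moreover have "f s \<le> f x"
        using x_max \<open>s \<in> S\<close> \<open>S \<subseteq> T\<close> by (auto intro: hull_inc)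
      ultimately show ?thesis
        using \<open>t \<in> T\<close> by (auto simp: K_def hull_inc)
    qed
  qed
  have "convex K"
    unfolding convex_alt
  proof (intro ballI allI impI)
    fix p q and u :: real
    assume p: "p \<in> K" and q: "q \<in> K" and u: "0 \<le> u \<and> u \<le> 1"
    let ?w = "(1 - u) *\<^sub>R p + u *\<^sub>R q"
    show "?w \<in> K"
    proof (cases "u = 0 \<or> u = 1 \<or> (p \<in> convex hull S \<and> q \<in> convex hull S)")
      case True
      moreover have "?w \<in> convex hull S" if "p \<in> convex hull S" "q \<in> convex hull S"
        using convex_convex_hull[of S] that u unfolding convex_alt by blast
      ultimately show ?thesis
        using p q by (auto simp: K_def)
    next
      case False
      then have u01: "0 < u" "u < 1" and strict: "f p < f x \<or> f q < f x"
        using u p q by (auto simp: K_def)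
      have w_hull: "?w \<in> convex hull T"
        using convex_convex_hull[of T] p q u K_sub unfolding convex_alt by blast
      have le: "f p \<le> f x" "f q \<le> f x"
        using p q K_sub x_max by auto
      have "f ?w \<le> (1 - u) * f p + u * f q"
        using f u by (auto simp: convex_on_def)
      also have "\<dots> < (1 - u) * f x + u * f x"
        using strict le u01
        by (auto intro: add_less_le_mono add_le_less_mono mult_left_mono mult_strict_left_mono)
      also have "\<dots> = f x" by (simp add: algebra_simps)
      finally show ?thesis
        using w_hull by (simp add: K_def)
    qed
  qed
  with T_sub have "convex hull T \<subseteq> K"
    by (rule hull_minimal)
  with x_hull show ?thesis
    by (auto simp: K_def)
qed

lemma optimal_solutions_convex_hull_eq:
  fixes f :: "'a::real_vector \<Rightarrow> real"
  assumes f: "convex_on UNIV f" and "S \<subseteq> T"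
    and dom: "\<And>t. t \<in> T - S \<Longrightarrow> \<exists>s\<in>S. f t < f s"
  shows "optimal_solutions f (convex hull S) = optimal_solutions f (convex hull T)"
proof (intro equalityI subsetI)
  have sub: "convex hull S \<subseteq> convex hull T"
    using \<open>S \<subseteq> T\<close> by (rule hull_mono)
  {
    fix x assume x: "x \<in> optimal_solutions f (convex hull S)"
    have weak: "\<exists>s\<in>S. f t \<le> f s" if "t \<in> T" for t
      using dom[of t] that by (cases "t \<in> S") (auto intro: less_imp_le)
    have "f z \<le> f x" if z: "z \<in> convex hull T" for z
    proof -
      obtain s where "s \<in> S" "f z \<le> f s"
        using convex_hull_dominated[OF f weak z] by blast
      moreover have "f s \<le> f x"
        using x \<open>s \<in> S\<close> by (simp add: optimal_solutions_def hull_inc)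
      ultimately show ?thesis by simp
    qed
    then show "x \<in> optimal_solutions f (convex hull T)"
      using x sub by (auto simp: optimal_solutions_def)
  next
    fix x assume x: "x \<in> optimal_solutions f (convex hull T)"
    with maximiser_in_convex_hull_subset[OF f \<open>S \<subseteq> T\<close> dom] sub
    show "x \<in> optimal_solutions f (convex hull S)"
      by (auto simp: optimal_solutions_def)
  }
qed

section \<open>Rounding the relaxed attack variables\<close>

lemma convex_on_attack_objective:
  "convex_on UNIV (attack_objective :: ('n::finite) attack_vars \<Rightarrow> real)"
proof (rule convex_onI)
  fix t :: real and x z :: "'n attack_vars"
  assume "0 < t" "t < 1"
  obtain v y b \<alpha> v' y' b' \<alpha>' where xz: "x = (v, y, b, \<alpha>)" "z = (v', y', b', \<alpha>')"
    by (metis prod.exhaust)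
  show "attack_objective ((1 - t) *\<^sub>R x + t *\<^sub>R z)
      \<le> (1 - t) * attack_objective x + t * attack_objective z"
    unfolding xz attack_objective_def
    by (simp add: sum.distrib flip: sum_distrib_left) (simp add: algebra_simps)
qed simp

definition integral_attack_points ::
    "((real, 'n::{finite, linorder}) vec, 'n) vec \<Rightarrow> (real, 'n) vec \<Rightarrow> real \<Rightarrow> 'n attack_vars set" where
  "integral_attack_points A a B = {(v, y, b, \<alpha>).
     (\<forall>i c. v $ i $ c \<in> {0, 1}) \<and> (\<forall>i j. y $ i $ j \<in> {0, 1}) \<and>
     (\<forall>c. b $ c \<in> {0, 1}) \<and> \<alpha> \<in> \<nat> \<and>
     attack_constraints A a B (v, y, b, \<alpha>)}"

definition relaxed_attack_points ::
    "((real, 'n::{finite, linorder}) vec, 'n) vec \<Rightarrow> (real, 'n) vec \<Rightarrow> real \<Rightarrow> 'n attack_vars set" where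
  "relaxed_attack_points A a B = {(v, y, b, \<alpha>).
     (\<forall>i c. v $ i $ c \<in> {0, 1}) \<and> (\<forall>i j. y $ i $ j \<in> {0, 1}) \<and>
     (\<forall>c. 0 \<le> b $ c \<and> b $ c \<le> 1) \<and> 0 \<le> \<alpha> \<and>
     attack_constraints A a B (v, y, b, \<alpha>)}"

lemma integral_subset_relaxed_attack_points:
  "integral_attack_points A a B \<subseteq> relaxed_attack_points A a B"
proof -
  have "0 \<le> r \<and> r \<le> 1" if "r \<in> {0, 1}" for r :: real
    using that by auto
  then show ?thesis
    unfolding integral_attack_points_def relaxed_attack_points_def
    by (auto elim!: Nats_cases)
qed

definition round_attack_vars :: "('n::finite) attack_vars \<Rightarrow> 'n attack_vars" where
  "round_attack_vars = (\<lambda>(v, y, b, \<alpha>).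
     (v, y, \<chi> c. min 1 (\<Sum>i\<in>UNIV. v $ i $ c), Max (range (\<lambda>c. \<Sum>i\<in>UNIV. v $ i $ c))))"

text \<open>
  Rounding lands on integers because each column sum of a binary \<open>v\<close> counts vertices, so it is a
  natural number and its minimum with 1 is 0 or 1.
\<close>

lemma round_attack_vars_integral:
  assumes "x \<in> relaxed_attack_points A a B"
  shows "round_attack_vars x \<in> integral_attack_points A a B"
proof -
  obtain v y b \<alpha> where x: "x = (v, y, b, \<alpha>)"
    by (metis prod.exhaust)
  define S where "S = (\<lambda>c. \<Sum>i\<in>UNIV. v $ i $ c)"
  have v: "v $ i $ c \<in> {0, 1}" for i c
    using assms by (simp add: x relaxed_attack_points_def)
  have nat: "S c \<in> \<nat>" for c
  proof -
    have "v $ i $ c = of_bool (v $ i $ c = 1)" for i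
      using v[of i c] by auto
    then have "S c = (\<Sum>i\<in>UNIV. of_bool (v $ i $ c = 1))"
      unfolding S_def by (intro sum.cong) auto
    also have "\<dots> = real (card {i. v $ i $ c = 1})"
      by (simp add: of_bool_def sum.If_cases)
    finally show ?thesis by simp
  qed
  have "Max (range S) \<in> range S"
    by (intro Max_in) auto
  then have "Max (range S) \<in> \<nat>"
    using nat by (metis imageE)
  moreover have "S c \<le> Max (range S)" for c
    by (intro Max_ge) auto
  moreover have "min 1 (S c) \<in> {0, 1}" for c
    using nat[of c] by (auto elim!: Nats_cases simp: min_def)
  ultimately show ?thesis
    using assms
    by (simp add: x relaxed_attack_points_def integral_attack_points_def round_attack_vars_def
        attack_constraints_def S_def)
qed

lemma round_attack_vars_improves:
  assumes "x \<in> relaxed_attack_points A a B" and "round_attack_vars x \<noteq> x"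
  shows "attack_objective x < attack_objective (round_attack_vars x)"
proof -
  obtain v y b \<alpha> where x: "x = (v, y, b, \<alpha>)"
    by (metis prod.exhaust)
  define S where "S = (\<lambda>c. \<Sum>i\<in>UNIV. v $ i $ c)"
  define m where "m = Max (range S)"
  have b_le: "b $ c \<le> min 1 (S c)" and S_le: "S c \<le> \<alpha>" for c
    using assms(1) by (simp_all add: x relaxed_attack_points_def attack_constraints_def S_def)
  have \<alpha>_ge: "m \<le> \<alpha>"
    unfolding m_def using S_le by (subst Max_le_iff) auto
  have sum_le: "(\<Sum>c\<in>UNIV. b $ c) \<le> (\<Sum>c\<in>UNIV. min 1 (S c))"
    using b_le by (rule sum_mono)
  have "b \<noteq> (\<chi> c. min 1 (S c)) \<or> m \<noteq> \<alpha>"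
    using assms(2) by (auto simp: x round_attack_vars_def S_def m_def)
  then have "(\<Sum>c\<in>UNIV. b $ c) < (\<Sum>c\<in>UNIV. min 1 (S c)) \<or> m < \<alpha>"
  proof
    assume "b \<noteq> (\<chi> c. min 1 (S c))"
    then obtain c where "b $ c \<noteq> min 1 (S c)"
      by (auto simp: vec_eq_iff)
    with b_le[of c] have "b $ c < min 1 (S c)" by linarith
    then have "(\<Sum>c\<in>UNIV. b $ c) < (\<Sum>c\<in>UNIV. min 1 (S c))"
      using b_le by (intro sum_strict_mono_ex1) auto
    then show ?thesis ..
  qed (use \<alpha>_ge in linarith)
  then have "(\<Sum>c\<in>UNIV. b $ c) - \<alpha> < (\<Sum>c\<in>UNIV. min 1 (S c)) - m"
    using sum_le \<alpha>_ge by linarith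
  moreover have "round_attack_vars x = (v, y, \<chi> c. min 1 (S c), m)"
    by (simp add: x round_attack_vars_def S_def m_def)
  ultimately show ?thesis
    unfolding x attack_objective_def by simp
qed

lemma relaxed_attack_point_dominated:
  assumes "x \<in> relaxed_attack_points A a B - integral_attack_points A a B"
  shows "\<exists>z\<in>integral_attack_points A a B. attack_objective x < attack_objective z"
  using assms round_attack_vars_integral round_attack_vars_improves by (metis DiffD1 DiffD2)

section \<open>Equivalence of the two attack problems\<close>

theorem proposition2:
  fixes A :: "((real, 'n::{finite, linorder}) vec, 'n) vec" and a :: "(real, 'n) vec" and B :: real
  assumes "adjacency_matrix A"
  shows "optimal_value attack_objective (attack_region A a B) =
           optimal_value attack_objective (relaxed_attack_region A a B) \<and>
         optimal_solutions attack_objective (attack_region A a B) =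
           optimal_solutions attack_objective (relaxed_attack_region A a B)"
proof -
  have regions: "attack_region A a B = convex hull integral_attack_points A a B"
    "relaxed_attack_region A a B = convex hull relaxed_attack_points A a B"
    by (simp_all only: attack_region_def relaxed_attack_region_def
        integral_attack_points_def relaxed_attack_points_def)
  have "\<exists>z\<in>integral_attack_points A a B. attack_objective x \<le> attack_objective z"
    if "x \<in> relaxed_attack_points A a B" for x
    using that relaxed_attack_point_dominated[of x A a B]
    by (cases "x \<in> integral_attack_points A a B") (auto intro: less_imp_le)
  then show ?thesis
    unfolding regions
    by (intro conjI optimal_value_convex_hull_eq optimal_solutions_convex_hull_eq
        convex_on_attack_objective integral_subset_relaxed_attack_points
        relaxed_attack_point_dominated)
qed

end
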